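(* For every integer $n > 1$, the constant $c_{n,2}$, defined as the volume ($2n$-dimensional Lebesgue measure) of the polyhedron $$V = \left\{ (x,y) \in \mathbb{R}^{n} \times \mathbb{R}^{n} : g(x,y) < 1 \right\},$$ where, for $x = (x_1,\ldots,x_n)$ and $y = (y_1,\ldots,y_n)$, $$g(x,y) = \max\{0, x_1, \ldots, x_n\} + \max\{0, y_1, \ldots, y_n\} + \max\{0, -x_1-y_1, \ldots, -x_n-y_n\},$$ is equal to $$c_{n,2} = \frac{(n+1)(2n+1)}{2^n}.$$
   Context: All notation is introduced in the claim. *)

theory Defs
  imports "HOL-Analysis.Analysis"
begin

definition g :: "real ^ 'n::finite \<Rightarrow> real ^ 'n \<Rightarrow> real" where
  "g x y = Max (insert 0 (range (\<lambda>i. x $ i)))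
         + Max (insert 0 (range (\<lambda>i. y $ i)))
         + Max (insert 0 (range (\<lambda>i. - (x $ i) - y $ i)))"

definition V :: "((real ^ 'n::finite) \<times> (real ^ 'n)) set" where
  "V = {(x, y). g x y < 1}"

(* The dimension n of the problem is CARD('n); the type argument only selects the index type.
   The measure is Lebesgue measure on the 2n-dimensional Euclidean space real^'n \<times> real^'n. *)
definition c2 :: "'n::finite itself \<Rightarrow> real" where
  "c2 _ = measure lebesgue (V :: ((real ^ 'n) \<times> (real ^ 'n)) set)"

end

theory Submission
  imports Defs "HOL-Probability.Distributions"
begin

text \<open>
  The volume is read off from \<open>\<integral> exp (- g)\<close>, which is computed in two ways.

  On the one hand \<open>g\<close> is nonnegative and positively homogeneous of degree 1, so its sublevel set at
  height \<open>t\<close> is a dilate of \<open>V\<close> and has volume \<open>t ^ (2 n) vol V\<close>.  Slicing by the value of \<open>g\<close>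
  gives \<open>\<integral> exp (- g) = vol V \<integral> t ^ (2 n) exp (- t) dt = (2 n)! vol V\<close>
  (\<open>nn_integral_exp_minus_homogeneous\<close>).

  On the other hand \<open>g\<close> is a sum of three maxima, and each factor
  \<open>exp (- max {0, x\<^sub>1, \<dots>, x\<^sub>n})\<close> is the integral of \<open>exp (- a)\<close> over all upper bounds \<open>a\<close> of
  \<open>0, x\<^sub>1, \<dots>, x\<^sub>n\<close>.  Exchanging the integrals (\<open>nn_integral_exp_minus_three\<close>), one needs for fixed
  \<open>a, b, c \<ge> 0\<close> the volume of the set of all \<open>(x, y)\<close> with \<open>x\<^sub>i \<le> a\<close>, \<open>y\<^sub>i \<le> b\<close> and
  \<open>- x\<^sub>i - y\<^sub>i \<le> c\<close>.  The maxima are gone and the coordinate pairs \<open>(x\<^sub>i, y\<^sub>i)\<close> are now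
  independent: each ranges over a right isosceles triangle with legs \<open>a + b + c\<close>, so the volume is
  \<open>((a + b + c)\<^sup>2 / 2) ^ n\<close> (\<open>emeasure_posmax_cell\<close>).  Everything depends on \<open>t = a + b + c\<close> only,
  and integrating over the simplices \<open>a + b + c = t\<close> contributes the factor \<open>t\<^sup>2 / 2\<close>
  (\<open>nn_integral_octant_sum\<close>).  Hence
  \<open>\<integral> exp (- g) = \<integral> (t\<^sup>2 / 2) ^ (n + 1) exp (- t) dt = (2 n + 2)! / 2 ^ (n + 1)\<close>, and dividing by
  \<open>(2 n)!\<close> gives the claim.

  All integrals are taken in the extended nonnegative reals, where Tonelli's theorem asks for
  measurability only; finiteness of the volume of \<open>V\<close> comes out of the computation.
\<close>

section \<open>Exponential integrals of homogeneous functions\<close>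

lemma nn_integral_lborel_swap:
  fixes f :: "'a::euclidean_space \<Rightarrow> 'b::euclidean_space \<Rightarrow> ennreal"
  assumes "case_prod f \<in> borel_measurable borel"
  shows "(\<integral>\<^sup>+x. \<integral>\<^sup>+y. f x y \<partial>lborel \<partial>lborel) = (\<integral>\<^sup>+y. \<integral>\<^sup>+x. f x y \<partial>lborel \<partial>lborel)"
  using assms by (intro lborel_pair.Fubini'[symmetric]) (simp add: lborel_prod)

lemma nn_integral_exp_tail:
  "(\<integral>\<^sup>+t. ennreal (exp (-t)) * indicator {X..} t \<partial>lborel) = ennreal (exp (-X))"
proof -
  have "((\<lambda>x::real. - exp (- x)) \<longlongrightarrow> - 0) at_top"
    by (intro tendsto_minus filterlim_compose[OF exp_at_bot] filterlim_uminus_at_bot_at_top)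
  then have "(\<integral>\<^sup>+t. ennreal (exp (-t)) * indicator {X..} t \<partial>lborel) = ennreal (- 0 - (- exp (-X)))"
    by (intro nn_integral_FTC_atLeast) (auto intro!: derivative_eq_intros)
  then show ?thesis by simp
qed

text \<open>
  Layer-cake formula.  The strict sublevel set matches the strict inequality that defines \<open>V\<close>; it
  agrees with the closed one for the exponential tail because a single height \<open>t\<close> is negligible.
\<close>
lemma nn_integral_exp_minus_layers:
  fixes f :: "'a::euclidean_space \<Rightarrow> real"
  assumes [measurable]: "f \<in> borel_measurable borel"
  shows "(\<integral>\<^sup>+p. ennreal (exp (- f p)) \<partial>lborel)
    = (\<integral>\<^sup>+t. ennreal (exp (-t)) * emeasure lborel {p. f p < t} \<partial>lborel)"
proof -
  have "(\<integral>\<^sup>+p. ennreal (exp (- f p)) \<partial>lborel)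
      = (\<integral>\<^sup>+p. \<integral>\<^sup>+t. ennreal (exp (-t)) * indicator {f p<..} t \<partial>lborel \<partial>lborel)"
  proof (rule nn_integral_cong)
    fix p
    have "(\<integral>\<^sup>+t. ennreal (exp (-t)) * indicator {f p<..} t \<partial>lborel)
        = (\<integral>\<^sup>+t. ennreal (exp (-t)) * indicator {f p..} t \<partial>lborel)"
      using AE_lborel_singleton[of "f p"]
      by (intro nn_integral_cong_AE) (auto split: split_indicator)
    then show "ennreal (exp (- f p)) = (\<integral>\<^sup>+t. ennreal (exp (-t)) * indicator {f p<..} t \<partial>lborel)"
      by (simp add: nn_integral_exp_tail)
  qed
  also have "\<dots> = (\<integral>\<^sup>+t. \<integral>\<^sup>+p. ennreal (exp (-t)) * indicator {f p<..} t \<partial>lborel \<partial>lborel)"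
    unfolding indicator_def
    by (intro nn_integral_lborel_swap) (simp add: case_prod_unfold flip: borel_prod)
  also have "\<dots> = (\<integral>\<^sup>+t. \<integral>\<^sup>+p. ennreal (exp (-t)) * indicator {p. f p < t} p \<partial>lborel \<partial>lborel)"
    by (simp add: indicator_def)
  also have "\<dots> = (\<integral>\<^sup>+t. ennreal (exp (-t)) * emeasure lborel {p. f p < t} \<partial>lborel)"
    by (subst nn_integral_cmult_indicator) auto
  finally show ?thesis .
qed

text \<open>
  Dilation by \<open>t > 0\<close> carries the sublevel set at height 1 onto the one at height \<open>t\<close>, so the layer
  at height \<open>t\<close> weighs \<open>t ^ DIM('a)\<close>, and the factorial is Euler's integral.  Turning a volume into an
  exponential integral pays off because the exponential of a sum of functions factorises.
\<close>
lemma nn_integral_exp_minus_homogeneous: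
  fixes f :: "'a::euclidean_space \<Rightarrow> real"
  assumes [measurable]: "f \<in> borel_measurable borel"
    and nonneg: "\<And>p. 0 \<le> f p"
    and homogeneous: "\<And>r p. 0 < r \<Longrightarrow> f (r *\<^sub>R p) = r * f p"
  shows "(\<integral>\<^sup>+p. ennreal (exp (- f p)) \<partial>lborel) = ennreal (fact DIM('a)) * emeasure lborel {p. f p < 1}"
proof -
  let ?d = "DIM('a)"
  have sub: "emeasure lborel {p. f p < t} = ennreal (t ^ ?d) * indicator {0..} t * emeasure lborel {p. f p < 1}" for t
  proof (cases "0 < t")
    case True
    have "{p. f p < t} = (\<lambda>p. t *\<^sub>R p + 0) ` {p. f p < 1}"
    proof (intro set_eqI iffI)
      fix p assume "p \<in> {p. f p < t}"
      then have "f ((1/t) *\<^sub>R p) < 1" "p = t *\<^sub>R ((1/t) *\<^sub>R p) + 0"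
        using True homogeneous[of "1/t" p] by auto
      then show "p \<in> (\<lambda>p. t *\<^sub>R p + 0) ` {p. f p < 1}" by blast
    qed (use True homogeneous in auto)
    then have "emeasure lebesgue {p. f p < t} = \<bar>t\<bar> ^ ?d * emeasure lebesgue {p. f p < 1}"
      by (simp only: emeasure_lebesgue_affine)
    then show ?thesis
      using True by simp
  next
    case False
    then have "{p. f p < t} = {}"
      using nonneg by (auto simp: not_less intro: order_trans)
    then show ?thesis
      using False by (auto simp: indicator_def)
  qed
  have "(\<integral>\<^sup>+p. ennreal (exp (- f p)) \<partial>lborel)
      = (\<integral>\<^sup>+t. ennreal (t ^ ?d * exp (-t)) * indicator {0..} t * emeasure lborel {p. f p < 1} \<partial>lborel)"
    unfolding nn_integral_exp_minus_layers[OF assms(1)]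
    \<comment> \<open>A single rewrite: the right-hand side of \<open>sub\<close> contains an instance of its left-hand side.\<close>
    by (intro nn_integral_cong, subst sub) (auto simp: ennreal_mult' mult_ac split: split_indicator)
  also have "\<dots> = ennreal (fact ?d) * emeasure lborel {p. f p < 1}"
    by (subst nn_integral_multc) (auto simp: nn_intergal_power_times_exp_Ici)
  finally show ?thesis .
qed

section \<open>Integrating a function of a sum over an octant\<close>

text \<open>
  The normalised powers \<open>s ^ k / k!\<close> on the half-line are the iterated convolutions of its indicator
  function, so one more integration raises \<open>k\<close> by one.
\<close>
lemma nn_integral_convolution_power:
  fixes h :: "real \<Rightarrow> ennreal"
  assumes [measurable]: "h \<in> borel_measurable borel"
  shows "(\<integral>\<^sup>+a. indicator {0..} a * (\<integral>\<^sup>+s. indicator {0..} s * ennreal (s ^ k / fact k) * h (a + s) \<partial>lborel) \<partial>lborel)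
    = (\<integral>\<^sup>+t. indicator {0..} t * ennreal (t ^ Suc k / fact (Suc k)) * h t \<partial>lborel)"
proof -
  have "(\<integral>\<^sup>+a. indicator {0..} a * (\<integral>\<^sup>+s. indicator {0..} s * ennreal (s ^ k / fact k) * h (a + s) \<partial>lborel) \<partial>lborel)
      = (\<integral>\<^sup>+a. \<integral>\<^sup>+t. indicator {0..} a * (indicator {0..} (t - a) * ennreal ((t - a) ^ k / fact k) * h t) \<partial>lborel \<partial>lborel)"
  proof (rule nn_integral_cong)
    fix a :: real
    have "(\<integral>\<^sup>+s. indicator {0..} s * ennreal (s ^ k / fact k) * h (a + s) \<partial>lborel)
        = (\<integral>\<^sup>+t. indicator {0..} (t - a) * ennreal ((t - a) ^ k / fact k) * h t \<partial>lborel)"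
      by (subst nn_integral_real_affine[where c = 1 and t = "-a"]) (auto simp: algebra_simps)
    then show "indicator {0..} a * (\<integral>\<^sup>+s. indicator {0..} s * ennreal (s ^ k / fact k) * h (a + s) \<partial>lborel)
        = (\<integral>\<^sup>+t. indicator {0..} a * (indicator {0..} (t - a) * ennreal ((t - a) ^ k / fact k) * h t) \<partial>lborel)"
      by (simp add: nn_integral_cmult)
  qed
  also have "\<dots> = (\<integral>\<^sup>+t. \<integral>\<^sup>+a. indicator {0..} a * (indicator {0..} (t - a) * ennreal ((t - a) ^ k / fact k) * h t) \<partial>lborel \<partial>lborel)"
    unfolding indicator_def
    by (intro nn_integral_lborel_swap) (simp add: case_prod_unfold flip: borel_prod)
  also have "\<dots> = (\<integral>\<^sup>+t. indicator {0..} t * ennreal (t ^ Suc k / fact (Suc k)) * h t \<partial>lborel)"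
  proof (rule nn_integral_cong)
    fix t :: real
    have "(\<integral>\<^sup>+a. indicator {0..} a * (indicator {0..} (t - a) * ennreal ((t - a) ^ k / fact k) * h t) \<partial>lborel)
        = (\<integral>\<^sup>+a. ennreal ((t - a) ^ k / fact k) * indicator {0..t} a * h t \<partial>lborel)"
      by (intro nn_integral_cong) (auto split: split_indicator)
    also have "\<dots> = (\<integral>\<^sup>+a. ennreal ((t - a) ^ k / fact k) * indicator {0..t} a \<partial>lborel) * h t"
      by (intro nn_integral_multc) auto
    also have "(\<integral>\<^sup>+a. ennreal ((t - a) ^ k / fact k) * indicator {0..t} a \<partial>lborel)
        = indicator {0..} t * ennreal (t ^ Suc k / fact (Suc k))"
    proof (cases "0 \<le> t")
      case True
      have "((\<lambda>a. - ((t - a) ^ Suc k / fact (Suc k))) has_real_derivative ((t - a) ^ k / fact k)) (at a)" for a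
        by (auto intro!: derivative_eq_intros simp: divide_simps simp del: power_Suc of_nat_Suc)
      then have "(\<integral>\<^sup>+a. ennreal ((t - a) ^ k / fact k) * indicator {0..t} a \<partial>lborel)
          = ennreal (- ((t - t) ^ Suc k / fact (Suc k)) - - ((t - 0) ^ Suc k / fact (Suc k)))"
        using True by (intro nn_integral_FTC_Icc) auto
      then show ?thesis using True by simp
    qed auto
    finally show "(\<integral>\<^sup>+a. indicator {0..} a * (indicator {0..} (t - a) * ennreal ((t - a) ^ k / fact k) * h t) \<partial>lborel)
      = indicator {0..} t * ennreal (t ^ Suc k / fact (Suc k)) * h t" .
  qed
  finally show ?thesis .
qed

lemma nn_integral_octant_sum:
  fixes h :: "real \<Rightarrow> ennreal"
  assumes [measurable]: "h \<in> borel_measurable borel"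
  shows "(\<integral>\<^sup>+a. indicator {0..} a * (\<integral>\<^sup>+b. indicator {0..} b * (\<integral>\<^sup>+c. indicator {0..} c * h (a + b + c) \<partial>lborel) \<partial>lborel) \<partial>lborel)
    = (\<integral>\<^sup>+t. indicator {0..} t * ennreal (t\<^sup>2 / 2) * h t \<partial>lborel)"
proof -
  have "(\<integral>\<^sup>+b. indicator {0..} b * (\<integral>\<^sup>+c. indicator {0..} c * h (a + b + c) \<partial>lborel) \<partial>lborel)
      = (\<integral>\<^sup>+s. indicator {0..} s * ennreal (s ^ 1 / fact 1) * h (a + s) \<partial>lborel)" for a
    using nn_integral_convolution_power[of "\<lambda>s. h (a + s)" 0] by (simp add: add.assoc)
  then show ?thesis
    using nn_integral_convolution_power[of h 1] by (simp add: power2_eq_square)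
qed

section \<open>Product sets in coordinate space\<close>

lemma nn_integral_lborel_vec_prod:
  fixes f :: "'n::finite \<Rightarrow> real \<Rightarrow> ennreal"
  assumes [measurable]: "\<And>i. f i \<in> borel_measurable borel"
  shows "(\<integral>\<^sup>+x. (\<Prod>i\<in>UNIV. f i (x $ i)) \<partial>lborel) = (\<Prod>i\<in>UNIV. \<integral>\<^sup>+u. f i u \<partial>lborel)"
proof -
  let ?e = "\<lambda>i::'n. axis i (1::real)"
  have Basis: "Basis = ?e ` UNIV"
    by (auto simp: Basis_vec_def)
  have inj: "inj ?e"
    by (auto simp: inj_on_def axis_eq_axis)
  show ?thesis
    using nn_integral_lborel_prod[where 'a = "real ^ 'n" and f = "\<lambda>b. f (inv ?e b)"]
    by (simp add: Basis prod.reindex[OF inj] inv_f_f[OF inj] inner_axis)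
qed

lemma emeasure_lborel_vec_box:
  fixes A :: "'n::finite \<Rightarrow> real set"
  assumes [measurable]: "\<And>i. A i \<in> sets borel"
  shows "emeasure lborel {y. \<forall>i. y $ i \<in> A i} = (\<Prod>i\<in>UNIV. emeasure lborel (A i))"
proof -
  have ind: "indicator {y. \<forall>i. y $ i \<in> A i} x = (\<Prod>i\<in>UNIV. indicator (A i) (x $ i) :: ennreal)" for x
    by (cases "\<forall>i. x $ i \<in> A i") (auto simp: indicator_def)
  have "emeasure lborel {y. \<forall>i. y $ i \<in> A i} = (\<integral>\<^sup>+x. indicator {y. \<forall>i. y $ i \<in> A i} x \<partial>lborel)"
    by (simp add: nn_integral_indicator)
  also have "\<dots> = (\<integral>\<^sup>+x. (\<Prod>i\<in>UNIV. indicator (A i) (x $ i)) \<partial>lborel)"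
    by (simp only: ind)
  also have "\<dots> = (\<Prod>i\<in>UNIV. emeasure lborel (A i))"
    by (subst nn_integral_lborel_vec_prod) auto
  finally show ?thesis .
qed

text \<open>
  Up to regrouping the coordinates the set is a power of \<open>T\<close>.  Slicing at a fixed \<open>x\<close> avoids the
  regrouping: the slice is a box whose \<open>i\<close>-th side depends on \<open>x $ i\<close> alone, so that the outer
  integrand is again a product over the coordinates.
\<close>
lemma emeasure_lborel_vec_pairs:
  fixes T :: "(real \<times> real) set"
  assumes T: "T \<in> sets borel"
  shows "emeasure lborel {(x :: real ^ 'n::finite, y :: real ^ 'n). \<forall>i. (x $ i, y $ i) \<in> T} = emeasure lborel T ^ CARD('n)"
proof -
  let ?S = "{z :: (real ^ 'n) \<times> (real ^ 'n). \<forall>i. (fst z $ i, snd z $ i) \<in> T}"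
  have T'[measurable]: "T \<in> sets (borel \<Otimes>\<^sub>M borel)"
    using T unfolding borel_prod .
  have [measurable]: "(\<lambda>z :: (real ^ 'n) \<times> (real ^ 'n). fst z $ i) \<in> borel_measurable (borel \<Otimes>\<^sub>M borel)"
    "(\<lambda>z :: (real ^ 'n) \<times> (real ^ 'n). snd z $ i) \<in> borel_measurable (borel \<Otimes>\<^sub>M borel)" for i :: 'n
    by (simp_all add: measurable_compose[OF measurable_fst borel_measurable_nth]
        measurable_compose[OF measurable_snd borel_measurable_nth])
  have "{z \<in> space (borel \<Otimes>\<^sub>M borel). \<forall>i. (fst z $ i, snd z $ i) \<in> T}
      \<in> sets ((borel :: (real ^ 'n) measure) \<Otimes>\<^sub>M (borel :: (real ^ 'n) measure))"
    by measurable
  then have S: "?S \<in> sets (borel \<Otimes>\<^sub>M borel)"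
    by (simp add: space_pair_measure)
  have "emeasure lborel ?S = (\<integral>\<^sup>+x. emeasure lborel (Pair x -` ?S) \<partial>lborel)"
    using S by (simp add: lborel.emeasure_pair_measure_alt flip: lborel_prod)
  also have "\<dots> = (\<integral>\<^sup>+x. (\<Prod>i\<in>UNIV. emeasure lborel (Pair (x $ i) -` T)) \<partial>(lborel :: (real ^ 'n) measure))"
  proof (rule nn_integral_cong)
    fix x :: "real ^ 'n"
    have "Pair x -` ?S = {y. \<forall>i. y $ i \<in> Pair (x $ i) -` T}"
      by auto
    then show "emeasure lborel (Pair x -` ?S) = (\<Prod>i\<in>UNIV. emeasure lborel (Pair (x $ i) -` T))"
      using sets_Pair1[OF T'] by (simp only: emeasure_lborel_vec_box)
  qed
  also have "\<dots> = (\<integral>\<^sup>+u. emeasure lborel (Pair u -` T) \<partial>lborel) ^ CARD('n)"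
  proof -
    have "(\<lambda>u. emeasure lborel (Pair u -` T)) \<in> borel_measurable borel"
      by (intro lborel.measurable_emeasure_Pair) (use T' in simp)
    then show ?thesis
      by (subst nn_integral_lborel_vec_prod) auto
  qed
  also have "(\<integral>\<^sup>+u. emeasure lborel (Pair u -` T) \<partial>lborel) = emeasure lborel T"
    using T' by (simp add: lborel.emeasure_pair_measure_alt flip: lborel_prod)
  finally show ?thesis
    by (simp add: case_prod_unfold)
qed

lemma sets_borel_triangle:
  fixes a b c :: real
  shows "{(u, v). u \<le> a \<and> v \<le> b \<and> - u - v \<le> c} \<in> sets borel"
proof -
  have "closed {z :: real \<times> real. fst z \<le> a \<and> snd z \<le> b \<and> - fst z - snd z \<le> c}"
    by (intro closed_Collect_conj closed_Collect_le continuous_intros)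
  then show ?thesis
    by (simp add: case_prod_unfold)
qed

lemma emeasure_triangle:
  fixes a b c :: real
  assumes "0 \<le> a + b + c"
  shows "emeasure lborel {(u, v). u \<le> a \<and> v \<le> b \<and> - u - v \<le> c} = ennreal ((a + b + c)\<^sup>2 / 2)"
proof -
  let ?T = "{(u, v). u \<le> a \<and> v \<le> b \<and> - u - v \<le> c}"
  have T: "?T \<in> sets (borel \<Otimes>\<^sub>M borel)"
    using sets_borel_triangle by (simp only: borel_prod)
  have "emeasure lborel ?T = (\<integral>\<^sup>+u. emeasure lborel (Pair u -` ?T) \<partial>lborel)"
    using T by (simp add: lborel.emeasure_pair_measure_alt flip: lborel_prod)
  also have "\<dots> = (\<integral>\<^sup>+u. ennreal (b + c + u) * indicator {- b - c..a} u \<partial>lborel)"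
  proof (rule nn_integral_cong)
    fix u :: real
    have "Pair u -` ?T = (if u \<le> a then {- c - u..b} else {})"
      by auto
    then show "emeasure lborel (Pair u -` ?T) = ennreal (b + c + u) * indicator {- b - c..a} u"
      by (auto simp: indicator_def emeasure_lborel_Icc_eq algebra_simps)
  qed
  also have "\<dots> = ennreal ((b + c + a)\<^sup>2 / 2 - (b + c + (- b - c))\<^sup>2 / 2)"
    using assms by (intro nn_integral_FTC_Icc) (auto intro!: derivative_eq_intros)
  finally show ?thesis
    by (simp add: add_ac)
qed

section \<open>Maxima of coordinates\<close>

definition posmax :: "real ^ 'n::finite \<Rightarrow> real" where
  "posmax x = Max (insert 0 (range (($) x)))"

text \<open>
  A bound on the maximum is a condition on each coordinate separately; this is what decouples the
  coordinates.
\<close>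
lemma posmax_le_iff: "posmax x \<le> a \<longleftrightarrow> 0 \<le> a \<and> (\<forall>i. x $ i \<le> a)"
  by (auto simp: posmax_def)

lemma posmax_nonneg: "0 \<le> posmax x"
  using posmax_le_iff[of x "posmax x"] by simp

lemma posmax_scaleR:
  assumes "0 < r"
  shows "posmax (r *\<^sub>R x) = r * posmax x"
proof (rule order_antisym)
  \<comment> \<open>Applied to \<open>1 / r\<close> as well, the upper bound yields the lower one.\<close>
  have le: "posmax (s *\<^sub>R z) \<le> s * posmax z" if "0 < s" for s and z :: "real ^ 'n"
    using that posmax_le_iff[of z "posmax z"]
    by (auto simp: posmax_le_iff)
  show "posmax (r *\<^sub>R x) \<le> r * posmax x"
    using le assms .
  show "r * posmax x \<le> posmax (r *\<^sub>R x)"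
    using le[of "1/r" "r *\<^sub>R x"] assms by (simp add: field_simps)
qed

lemma borel_measurable_posmax [measurable]:
  "posmax \<in> borel_measurable borel"
  unfolding borel_measurable_iff_le posmax_le_iff by measurable

lemma g_posmax: "g x y = posmax x + posmax y + posmax (- x - y)"
  by (simp add: g_def posmax_def)

text \<open>
  The indicators are needed: a negative bound makes the set empty, since 0 takes part in each maximum,
  whereas the power on the right-hand side may well be positive.
\<close>
lemma emeasure_posmax_cell:
  fixes a b c :: real
  shows "emeasure lborel {(x, y :: real ^ 'n::finite). posmax x \<le> a \<and> posmax y \<le> b \<and> posmax (- x - y) \<le> c}
    = indicator {0..} a * (indicator {0..} b * (indicator {0..} c * ennreal (((a + b + c)\<^sup>2 / 2) ^ CARD('n))))"
proof (cases "0 \<le> a \<and> 0 \<le> b \<and> 0 \<le> c")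
  case True
  let ?T = "{(u, v). u \<le> a \<and> v \<le> b \<and> - u - v \<le> c}"
  have "{(x, y :: real ^ 'n). posmax x \<le> a \<and> posmax y \<le> b \<and> posmax (- x - y) \<le> c}
      = {(x, y). \<forall>i. (x $ i, y $ i) \<in> ?T}"
    using True by (auto simp: posmax_le_iff)
  then show ?thesis
    using True emeasure_lborel_vec_pairs[OF sets_borel_triangle[of a b c], where 'n = 'n]
    by (simp add: emeasure_triangle ennreal_power)
next
  case False
  then have empty: "{(x, y :: real ^ 'n). posmax x \<le> a \<and> posmax y \<le> b \<and> posmax (- x - y) \<le> c} = {}"
    by (auto simp: posmax_le_iff)
  show ?thesis
    unfolding empty using False by (auto simp: indicator_def)
qed

section \<open>Tonelli's theorem for three exponential tails\<close>

text \<open>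
  Replaces one factor \<open>exp (- p z)\<close> by the integral of \<open>exp (- a)\<close> over \<open>a \<ge> p z\<close> and moves that
  integral outside.  The weight \<open>w\<close> carries the other factors along, so the step can be repeated.
\<close>
lemma nn_integral_exp_minus_mult:
  fixes p :: "'a::euclidean_space \<Rightarrow> real" and w :: "'a \<Rightarrow> ennreal"
  assumes [measurable]: "p \<in> borel_measurable borel" "w \<in> borel_measurable borel"
  shows "(\<integral>\<^sup>+z. ennreal (exp (- p z)) * w z \<partial>lborel)
    = (\<integral>\<^sup>+a. ennreal (exp (- a)) * (\<integral>\<^sup>+z. indicator {z. p z \<le> a} z * w z \<partial>lborel) \<partial>lborel)"
proof -
  have "(\<integral>\<^sup>+z. ennreal (exp (- p z)) * w z \<partial>lborel)
      = (\<integral>\<^sup>+z. (\<integral>\<^sup>+a. ennreal (exp (- a)) * indicator {p z..} a \<partial>lborel) * w z \<partial>lborel)"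
    by (simp only: nn_integral_exp_tail)
  also have "\<dots> = (\<integral>\<^sup>+z. \<integral>\<^sup>+a. ennreal (exp (- a)) * (indicator {z. p z \<le> a} z * w z) \<partial>lborel \<partial>lborel)"
    by (subst nn_integral_multc[symmetric]) (auto simp: indicator_def mult.assoc)
  also have "\<dots> = (\<integral>\<^sup>+a. \<integral>\<^sup>+z. ennreal (exp (- a)) * (indicator {z. p z \<le> a} z * w z) \<partial>lborel \<partial>lborel)"
    unfolding indicator_def
    by (intro nn_integral_lborel_swap) (simp add: case_prod_unfold flip: borel_prod)
  also have "\<dots> = (\<integral>\<^sup>+a. ennreal (exp (- a)) * (\<integral>\<^sup>+z. indicator {z. p z \<le> a} z * w z \<partial>lborel) \<partial>lborel)"
    by (subst nn_integral_cmult) auto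
  finally show ?thesis .
qed

lemma nn_integral_exp_minus_three:
  fixes p q r :: "'a::euclidean_space \<Rightarrow> real"
  assumes [measurable]: "p \<in> borel_measurable borel" "q \<in> borel_measurable borel" "r \<in> borel_measurable borel"
  shows "(\<integral>\<^sup>+z. ennreal (exp (- (p z + q z + r z))) \<partial>lborel)
    = (\<integral>\<^sup>+a. ennreal (exp (- a)) * (\<integral>\<^sup>+b. ennreal (exp (- b)) * (\<integral>\<^sup>+c. ennreal (exp (- c)) *
        emeasure lborel {z. p z \<le> a \<and> q z \<le> b \<and> r z \<le> c} \<partial>lborel) \<partial>lborel) \<partial>lborel)"
proof -
  let ?P = "\<lambda>a z. indicator {z. p z \<le> a} z :: ennreal"
  let ?Q = "\<lambda>b z. indicator {z. q z \<le> b} z :: ennreal"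
  let ?R = "\<lambda>c z. indicator {z. r z \<le> c} z :: ennreal"
  have cell: "(\<integral>\<^sup>+z. ?R c z * (?P a z * ?Q b z) \<partial>lborel) = emeasure lborel {z. p z \<le> a \<and> q z \<le> b \<and> r z \<le> c}" for a b c
  proof -
    have "(\<integral>\<^sup>+z. ?R c z * (?P a z * ?Q b z) \<partial>lborel) = (\<integral>\<^sup>+z. indicator {z. p z \<le> a \<and> q z \<le> b \<and> r z \<le> c} z \<partial>lborel)"
      by (intro nn_integral_cong) (auto split: split_indicator)
    then show ?thesis by simp
  qed
  have "(\<integral>\<^sup>+z. ennreal (exp (- (p z + q z + r z))) \<partial>lborel)
      = (\<integral>\<^sup>+z. ennreal (exp (- p z)) * (ennreal (exp (- q z)) * ennreal (exp (- r z))) \<partial>lborel)"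
    by (simp add: algebra_simps flip: ennreal_mult exp_add)
  also have "\<dots> = (\<integral>\<^sup>+a. ennreal (exp (- a)) * (\<integral>\<^sup>+z. ?P a z * (ennreal (exp (- q z)) * ennreal (exp (- r z))) \<partial>lborel) \<partial>lborel)"
    by (intro nn_integral_exp_minus_mult) auto
  also have "\<dots> = (\<integral>\<^sup>+a. ennreal (exp (- a)) * (\<integral>\<^sup>+z. ennreal (exp (- q z)) * (?P a z * ennreal (exp (- r z))) \<partial>lborel) \<partial>lborel)"
    by (simp only: mult.left_commute)
  also have "\<dots> = (\<integral>\<^sup>+a. ennreal (exp (- a)) * (\<integral>\<^sup>+b. ennreal (exp (- b)) * (\<integral>\<^sup>+z. ?Q b z * (?P a z * ennreal (exp (- r z))) \<partial>lborel) \<partial>lborel) \<partial>lborel)"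
    by (subst nn_integral_exp_minus_mult) auto
  also have "\<dots> = (\<integral>\<^sup>+a. ennreal (exp (- a)) * (\<integral>\<^sup>+b. ennreal (exp (- b)) * (\<integral>\<^sup>+z. ennreal (exp (- r z)) * (?P a z * ?Q b z) \<partial>lborel) \<partial>lborel) \<partial>lborel)"
    by (simp only: mult_ac)
  also have "\<dots> = (\<integral>\<^sup>+a. ennreal (exp (- a)) * (\<integral>\<^sup>+b. ennreal (exp (- b)) * (\<integral>\<^sup>+c. ennreal (exp (- c)) *
        (\<integral>\<^sup>+z. ?R c z * (?P a z * ?Q b z) \<partial>lborel) \<partial>lborel) \<partial>lborel) \<partial>lborel)"
    by (subst nn_integral_exp_minus_mult) auto
  finally show ?thesis
    unfolding cell .
qed

section \<open>The volume\<close>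

lemma nn_integral_exp_minus_g:
  "(\<integral>\<^sup>+z. ennreal (exp (- g (fst z) (snd z))) \<partial>(lborel :: ((real ^ 'n::finite) \<times> (real ^ 'n)) measure))
    = ennreal (fact (2 * CARD('n) + 2) / 2 ^ (CARD('n) + 1))"
proof -
  let ?n = "CARD('n)"
  let ?h = "\<lambda>t. ennreal (exp (- t) * (t\<^sup>2 / 2) ^ ?n)"
  have h: "?h (a + b + c) = ennreal (exp (- a)) * (ennreal (exp (- b)) * (ennreal (exp (- c)) * ennreal (((a + b + c)\<^sup>2 / 2) ^ ?n)))" for a b c
    by (simp add: algebra_simps flip: ennreal_mult' exp_add)
  have [measurable]: "(\<lambda>z :: (real ^ 'n) \<times> (real ^ 'n). posmax (fst z)) \<in> borel_measurable borel"
    "(\<lambda>z :: (real ^ 'n) \<times> (real ^ 'n). posmax (snd z)) \<in> borel_measurable borel"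
    "(\<lambda>z :: (real ^ 'n) \<times> (real ^ 'n). posmax (- fst z - snd z)) \<in> borel_measurable borel"
    by (simp_all flip: borel_prod)
  have cell: "emeasure lborel {z :: (real ^ 'n) \<times> (real ^ 'n). posmax (fst z) \<le> a \<and> posmax (snd z) \<le> b \<and> posmax (- fst z - snd z) \<le> c}
    = indicator {0..} a * (indicator {0..} b * (indicator {0..} c * ennreal (((a + b + c)\<^sup>2 / 2) ^ ?n)))" for a b c
    using emeasure_posmax_cell[of a b c, where 'n = 'n] by (simp add: case_prod_unfold)
  have "(\<integral>\<^sup>+z. ennreal (exp (- g (fst z) (snd z))) \<partial>(lborel :: ((real ^ 'n) \<times> (real ^ 'n)) measure))
      = (\<integral>\<^sup>+a. ennreal (exp (- a)) * (\<integral>\<^sup>+b. ennreal (exp (- b)) * (\<integral>\<^sup>+c. ennreal (exp (- c)) *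
          (indicator {0..} a * (indicator {0..} b * (indicator {0..} c * ennreal (((a + b + c)\<^sup>2 / 2) ^ ?n)))) \<partial>lborel) \<partial>lborel) \<partial>lborel)"
    unfolding g_posmax by (subst nn_integral_exp_minus_three) (auto simp: cell)
  also have "\<dots> = (\<integral>\<^sup>+a. indicator {0..} a * (\<integral>\<^sup>+b. indicator {0..} b * (\<integral>\<^sup>+c. indicator {0..} c * ?h (a + b + c) \<partial>lborel) \<partial>lborel) \<partial>lborel)"
    unfolding h by (simp add: mult_ac flip: nn_integral_cmult)
  also have "\<dots> = (\<integral>\<^sup>+t. indicator {0..} t * ennreal (t\<^sup>2 / 2) * ?h t \<partial>lborel)"
    by (intro nn_integral_octant_sum) simp
  also have "\<dots> = (\<integral>\<^sup>+t. ennreal (1 / 2 ^ (?n + 1)) * (ennreal (t ^ (2 * ?n + 2) * exp (- t)) * indicator {0..} t) \<partial>lborel)"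
    by (intro nn_integral_cong)
       (auto simp: power_divide power_mult power_add power_mult_distrib power2_eq_square mult_ac simp flip: ennreal_mult' split: split_indicator)
  also have "\<dots> = ennreal (1 / 2 ^ (?n + 1)) * ennreal (fact (2 * ?n + 2))"
    by (subst nn_integral_cmult) (auto simp: nn_intergal_power_times_exp_Ici simp del: fact_Suc power_Suc power_add add_2_eq_Suc' mult_Suc_right)
  also have "\<dots> = ennreal (fact (2 * ?n + 2) / 2 ^ (?n + 1))"
    by (simp flip: ennreal_mult' del: fact_Suc)
  finally show ?thesis .
qed

theorem mainTheorem2:
  fixes n :: nat
  assumes "CARD('n::finite) = n"
    and "n > 1"
  shows "c2 TYPE('n) = (real n + 1) * (2 * real n + 1) / 2 ^ n"
proof -
  let ?f = "\<lambda>z :: (real ^ 'n) \<times> (real ^ 'n). g (fst z) (snd z)"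
  have meas[measurable]: "?f \<in> borel_measurable borel"
    unfolding g_posmax by (simp flip: borel_prod)
  have "?f (r *\<^sub>R z) = r * ?f z" if "0 < r" for r z
    using that posmax_scaleR[of r "- fst z - snd z"]
    by (simp add: g_posmax posmax_scaleR algebra_simps)
  moreover have "0 \<le> ?f z" for z
    by (simp add: g_posmax posmax_nonneg)
  ultimately have "(\<integral>\<^sup>+z. ennreal (exp (- ?f z)) \<partial>lborel) = ennreal (fact DIM((real ^ 'n) \<times> (real ^ 'n))) * emeasure lborel {z. ?f z < 1}"
    by (intro nn_integral_exp_minus_homogeneous meas)
  moreover have V: "V = {z. ?f z < 1}"
    by (auto simp: V_def)
  moreover have "DIM((real ^ 'n) \<times> (real ^ 'n)) = 2 * n"
    using assms by simp
  ultimately have eq: "ennreal (fact (2 * n)) * emeasure lborel (V :: ((real ^ 'n) \<times> (real ^ 'n)) set)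
      = ennreal (fact (2 * n + 2) / 2 ^ (n + 1))"
    using nn_integral_exp_minus_g[where 'n = 'n] unfolding assms(1) by simp
  have "V \<in> sets (lborel :: ((real ^ 'n) \<times> (real ^ 'n)) measure)"
    unfolding V by simp
  then have "c2 TYPE('n) = measure lborel (V :: ((real ^ 'n) \<times> (real ^ 'n)) set)"
    by (simp add: c2_def measure_completion)
  moreover have "fact (2 * n) * measure lborel (V :: ((real ^ 'n) \<times> (real ^ 'n)) set) = fact (2 * n + 2) / 2 ^ (n + 1)"
    using arg_cong[OF eq, of enn2real] by (simp add: enn2real_mult measure_def del: fact_Suc)
  moreover have "(fact (2 * n + 2) :: real) = fact (2 * n) * (2 * ((real n + 1) * (2 * real n + 1)))"
    by (simp add: algebra_simps)
  ultimately have "fact (2 * n) * c2 TYPE('n) = fact (2 * n) * ((real n + 1) * (2 * real n + 1) / 2 ^ n)"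
    by (simp only: power_add) simp
  then show ?thesis
    by (subst (asm) mult_left_cancel) simp_all
qed

end
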